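(* For every $1\le p<\infty$ and every $\mathbf{w}\in\mathcal{W}$, the Banach space $g(\mathbf{w},p)$ is not superreflexive.
   Context: Scalars are in $\mathbb{F}=\mathbb{R}$ or $\mathbb{C}$. $\mathcal{W}$ denotes the set of weights $\mathbf{w}=(w_j)_{j=1}^\infty\in c_0\setminus\ell_1$ with $1=w_1\ge w_2\ge\cdots\ge w_j\ge w_{j+1}\ge\cdots>0$. Let $\mathcal{O}$ be the set of all (strictly) increasing functions from $\mathbb{N}=\{1,2,\dots\}$ to $\mathbb{N}$. For $1\le p<\infty$ and $\mathbf{w}\in\mathcal{W}$, the Garling sequence space $g(\mathbf{w},p)$ is the Banach space of all scalar sequences $f=(a_j)_{j=1}^\infty$ such that $$\|f\|_{g(\mathbf{w},p)}=\sup_{\phi\in\mathcal{O}}\left(\sum_{j=1}^\infty |a_{\phi(j)}|^p w_j\right)^{1/p}<\infty.$$ *)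

theory Defs
  imports "HOL-Analysis.Analysis" "HOL-Library.Function_Algebras"
begin

text \<open>
  Normed spaces are presented as a linear subspace \<open>V\<close> of some \<open>'i \<Rightarrow> 'k\<close>, with pointwise
  operations, together with a norm \<open>N\<close> on \<open>V\<close> (the values of \<open>N\<close> outside \<open>V\<close> are irrelevant).
  This loses no generality, since every vector space is isomorphic to a space of scalar functions on
  some index set, and it is closed under taking duals: the dual consists of functions with index
  type \<open>'i \<Rightarrow> 'k\<close>.  The scalars \<open>'k\<close> are meant to be \<open>real\<close> or \<open>complex\<close>.
\<close>

definition pscale :: "'k::real_normed_field \<Rightarrow> ('i \<Rightarrow> 'k) \<Rightarrow> 'i \<Rightarrow> 'k" where
  "pscale c f = (\<lambda>i. c * f i)"

interpretation fs: vector_space pscale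
  by unfold_locales (auto simp: pscale_def algebra_simps fun_eq_iff)

definition linear_on ::
  "('i \<Rightarrow> 'k::real_normed_field) set \<Rightarrow> ('k \<Rightarrow> 'b \<Rightarrow> 'b) \<Rightarrow> (('i \<Rightarrow> 'k) \<Rightarrow> 'b::ab_group_add) \<Rightarrow> bool"
where
  "linear_on V sc T \<longleftrightarrow>
     (\<forall>x\<in>V. \<forall>y\<in>V. T (x + y) = T x + T y) \<and> (\<forall>c. \<forall>x\<in>V. T (pscale c x) = sc c (T x))"

locale normed_space_on =
  fixes V :: "('i \<Rightarrow> 'k::real_normed_field) set" and N :: "('i \<Rightarrow> 'k) \<Rightarrow> real"
  assumes subspace: "fs.subspace V"
    and norm_nonneg: "x \<in> V \<Longrightarrow> 0 \<le> N x"
    and norm_eq_0: "x \<in> V \<Longrightarrow> N x = 0 \<longleftrightarrow> x = 0"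
    and norm_triangle: "x \<in> V \<Longrightarrow> y \<in> V \<Longrightarrow> N (x + y) \<le> N x + N y"
    and norm_scale: "x \<in> V \<Longrightarrow> N (pscale c x) = norm c * N x"

locale banach_space_on = normed_space_on +
  assumes complete:
    "(\<And>n::nat. X n \<in> V) \<Longrightarrow> (\<forall>e>0. \<exists>M. \<forall>m\<ge>M. \<forall>n\<ge>M. N (X m - X n) < e) \<Longrightarrow>
     \<exists>l\<in>V. (\<lambda>n. N (X n - l)) \<longlonglongrightarrow> 0"

text \<open>
  Bounded linear functionals on \<open>V\<close> are extended by \<open>0\<close> outside \<open>V\<close>, so that each of them is
  represented by exactly one function and the dual is again a space with pointwise operations.
\<close>

definition dual_space ::
  "('i \<Rightarrow> 'k::real_normed_field) set \<Rightarrow> (('i \<Rightarrow> 'k) \<Rightarrow> real) \<Rightarrow> (('i \<Rightarrow> 'k) \<Rightarrow> 'k) set"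
where
  "dual_space V N =
     {f. linear_on V (*) f \<and> (\<exists>C. \<forall>x\<in>V. norm (f x) \<le> C * N x) \<and> (\<forall>x. x \<notin> V \<longrightarrow> f x = 0)}"

definition dual_norm ::
  "('i \<Rightarrow> 'k::real_normed_field) set \<Rightarrow> (('i \<Rightarrow> 'k) \<Rightarrow> real) \<Rightarrow> (('i \<Rightarrow> 'k) \<Rightarrow> 'k) \<Rightarrow> real"
where
  "dual_norm V N f = (SUP x\<in>{x \<in> V. N x \<le> 1}. norm (f x))"

text \<open>Surjectivity of the canonical embedding into the bidual.\<close>

definition reflexive_space ::
  "('i \<Rightarrow> 'k::real_normed_field) set \<Rightarrow> (('i \<Rightarrow> 'k) \<Rightarrow> real) \<Rightarrow> bool"
where
  "reflexive_space V N \<longleftrightarrow>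
     (\<forall>\<Phi> \<in> dual_space (dual_space V N) (dual_norm V N).
        \<exists>x\<in>V. \<forall>f \<in> dual_space V N. \<Phi> f = f x)"

text \<open>\<open>(W, M)\<close> is finitely representable in \<open>(V, N)\<close>, following James.\<close>

definition finitely_representable ::
  "('j \<Rightarrow> 'k::real_normed_field) set \<Rightarrow> (('j \<Rightarrow> 'k) \<Rightarrow> real) \<Rightarrow>
   ('i \<Rightarrow> 'k) set \<Rightarrow> (('i \<Rightarrow> 'k) \<Rightarrow> real) \<Rightarrow> bool"
where
  "finitely_representable W M V N \<longleftrightarrow>
     (\<forall>F r. fs.subspace F \<and> F \<subseteq> W \<and> (\<exists>B. finite B \<and> F = fs.span B) \<and> r > 1 \<longrightarrow>
        (\<exists>T. linear_on F pscale T \<and> T ` F \<subseteq> V \<and>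
             (\<forall>x\<in>F. inverse r * M x \<le> N (T x) \<and> N (T x) \<le> r * M x)))"

text \<open>
  A Banach space is superreflexive if every Banach space finitely representable in it is reflexive.
  A quantifier over all types is not available; here the Banach spaces \<open>(W, M)\<close> range over all
  subspaces \<open>W\<close> of \<open>nat \<Rightarrow> 'k\<close> with arbitrary complete norms \<open>M\<close>.  For real or complex scalars these
  are, up to isometric isomorphism, all Banach spaces of algebraic dimension at most the continuum,
  in particular all separable ones.  This is enough: a non-reflexive Banach space has a separable
  non-reflexive closed subspace, and finite representability passes to subspaces.
\<close>

definition superreflexive ::
  "('i \<Rightarrow> 'k::real_normed_field) set \<Rightarrow> (('i \<Rightarrow> 'k) \<Rightarrow> real) \<Rightarrow> bool"
where
  "superreflexive V N \<longleftrightarrow>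
     (\<forall>(W :: (nat \<Rightarrow> 'k) set) M.
        banach_space_on W M \<and> finitely_representable W M V N \<longrightarrow> reflexive_space W M)"

text \<open>
  Sequences are indexed from \<open>0\<close>: \<open>w j\<close> stands for \<open>w\<^sub>j\<^sub>+\<^sub>1\<close>, and strictly increasing maps of the
  positive integers become strictly increasing maps of \<open>nat\<close>.
\<close>

definition weights :: "(nat \<Rightarrow> real) set" where
  "weights = {w. w 0 = 1 \<and> decseq w \<and> (\<forall>j. w j > 0) \<and> w \<longlonglongrightarrow> 0 \<and> \<not> summable w}"

definition garling_sum ::
  "(nat \<Rightarrow> real) \<Rightarrow> real \<Rightarrow> (nat \<Rightarrow> 'k::real_normed_field) \<Rightarrow> (nat \<Rightarrow> nat) \<Rightarrow> real"
where
  "garling_sum w p a \<phi> = (\<Sum>j. norm (a (\<phi> j)) powr p * w j) powr (1 / p)"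

definition garling_norm :: "(nat \<Rightarrow> real) \<Rightarrow> real \<Rightarrow> (nat \<Rightarrow> 'k::real_normed_field) \<Rightarrow> real" where
  "garling_norm w p a = (SUP \<phi>\<in>{\<phi>. strict_mono \<phi>}. garling_sum w p a \<phi>)"

text \<open>
  As \<open>suminf\<close> and the supremum are real-valued, finiteness of the norm is expressed by summability
  along each \<open>\<phi>\<close> and boundedness over all \<open>\<phi>\<close>.
\<close>

definition garling_space :: "(nat \<Rightarrow> real) \<Rightarrow> real \<Rightarrow> (nat \<Rightarrow> 'k::real_normed_field) set" where
  "garling_space w p =
     {a. (\<forall>\<phi>. strict_mono \<phi> \<longrightarrow> summable (\<lambda>j. norm (a (\<phi> j)) powr p * w j)) \<and>
         bdd_above (garling_sum w p a ` {\<phi>. strict_mono \<phi>})}"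

end

theory Submission
  imports Defs
begin

text \<open>
  The space \<open>c\<^sub>0\<close> is not reflexive, so it is enough that \<open>c\<^sub>0\<close> is finitely representable in the
  Garling space.

  On the one hand, \<open>g(w,p)\<close> contains almost isometric copies of \<open>\<ell>\<^sub>\<infinity>\<^sup>n\<close> for every \<open>n\<close>, spanned by
  disjoint flat blocks in which long low blocks precede short high ones
  (\<open>flat_blocks_almost_isometric\<close>).  The selected subsequences have to respect the order of the
  indices.  To collect a substantial part of the norm of a long low block, a subsequence must take
  many of its terms; the weights that remain for the later, short blocks are then small, since the
  weights tend to \<open>0\<close>.  If it takes few of those terms, then these contribute little, since the
  weights have an infinite sum and the block is as low as one likes.  So one block at a time counts,
  and the norm of the sum of the blocks is close to the norm of each of them.  As the norm is
  monotone in the moduli of the entries, the norm of a linear combination of the blocks is then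
  close to the largest modulus of its coefficients.

  On the other hand, on a finite-dimensional subspace of \<open>c\<^sub>0\<close> the sup norm is attained on
  a fixed finite set of coordinates (\<open>finite_dim_c0_tails\<close>), so that such a subspace lies
  isometrically in some \<open>\<ell>\<^sub>\<infinity>\<^sup>n\<close>.
\<close>

section \<open>The Banach space of null sequences\<close>

definition c0_space :: "(nat \<Rightarrow> 'k::real_normed_field) set" where
  "c0_space = {x. x \<longlonglongrightarrow> 0}"

definition sup_norm :: "(nat \<Rightarrow> 'k::real_normed_field) \<Rightarrow> real" where
  "sup_norm x = (SUP i. norm (x i))"

lemma norm_le_sup_norm:
  assumes "x \<in> c0_space"
  shows "norm (x i) \<le> sup_norm x"
proof -
  have "Bseq x"
    using assms by (auto simp: c0_space_def intro: convergent_imp_Bseq convergentI)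
  then have "bdd_above (range (\<lambda>i. norm (x i)))"
    by (auto simp: Bseq_def intro: bdd_aboveI2)
  then show ?thesis
    unfolding sup_norm_def by (intro cSUP_upper) auto
qed

lemma sup_norm_least: "(\<And>i. norm (x i) \<le> K) \<Longrightarrow> sup_norm x \<le> K"
  unfolding sup_norm_def by (intro cSUP_least) auto

lemma sup_norm_nonneg: "x \<in> c0_space \<Longrightarrow> 0 \<le> sup_norm x"
  using norm_le_sup_norm[of x 0] norm_ge_zero[of "x 0"] by linarith

lemma subspace_c0: "fs.subspace c0_space"
  unfolding fs.subspace_def
proof (intro conjI ballI allI)
  show "0 \<in> c0_space" by (simp add: c0_space_def zero_fun_def)
next
  fix x y :: "nat \<Rightarrow> 'a"
  assume "x \<in> c0_space" "y \<in> c0_space"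
  then show "x + y \<in> c0_space"
    using tendsto_add[of x 0 sequentially y 0] by (simp add: c0_space_def plus_fun_def)
next
  fix c and x :: "nat \<Rightarrow> 'a"
  assume "x \<in> c0_space"
  then show "pscale c x \<in> c0_space"
    using tendsto_mult_left[of x 0 sequentially c] by (simp add: c0_space_def pscale_def)
qed

lemma sup_norm_scale:
  assumes "x \<in> c0_space"
  shows "sup_norm (pscale c x) = norm c * sup_norm x"
proof (cases "c = 0")
  case True
  then show ?thesis by (simp add: sup_norm_def pscale_def)
next
  case False
  show ?thesis
  proof (rule antisym)
    show "sup_norm (pscale c x) \<le> norm c * sup_norm x"
      by (rule sup_norm_least)
        (simp add: pscale_def norm_mult mult_left_mono norm_le_sup_norm[OF assms])
    have "pscale c x \<in> c0_space"
      using assms by (rule fs.subspace_scale[OF subspace_c0])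
    then have "norm c * norm (x i) \<le> sup_norm (pscale c x)" for i
      using norm_le_sup_norm[of "pscale c x" i] by (simp add: pscale_def norm_mult)
    then have "sup_norm x \<le> sup_norm (pscale c x) / norm c"
      using False by (intro sup_norm_least) (simp add: field_simps)
    then show "norm c * sup_norm x \<le> sup_norm (pscale c x)"
      using False by (simp add: field_simps)
  qed
qed

lemma normed_space_c0: "normed_space_on c0_space sup_norm"
proof
  show "fs.subspace c0_space" by (rule subspace_c0)
next
  fix x :: "nat \<Rightarrow> 'a"
  assume x: "x \<in> c0_space"
  show "0 \<le> sup_norm x" using x by (rule sup_norm_nonneg)
  show "sup_norm x = 0 \<longleftrightarrow> x = 0"
  proof
    assume "sup_norm x = 0"
    then show "x = 0"
      using norm_le_sup_norm[OF x] by (simp add: fun_eq_iff)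
  next
    assume "x = 0"
    then show "sup_norm x = 0" by (simp add: sup_norm_def)
  qed
  show "sup_norm (pscale c x) = norm c * sup_norm x" for c
    using x by (rule sup_norm_scale)
  fix y :: "nat \<Rightarrow> 'a"
  assume y: "y \<in> c0_space"
  show "sup_norm (x + y) \<le> sup_norm x + sup_norm y"
  proof (rule sup_norm_least)
    fix i
    have "norm ((x + y) i) \<le> norm (x i) + norm (y i)"
      by (simp add: norm_triangle_ineq)
    also have "\<dots> \<le> sup_norm x + sup_norm y"
      by (intro add_mono norm_le_sup_norm x y)
    finally show "norm ((x + y) i) \<le> sup_norm x + sup_norm y" .
  qed
qed

lemma banach_space_c0:
  "banach_space_on (c0_space :: (nat \<Rightarrow> 'k::{real_normed_field, banach}) set) sup_norm"
proof -
  interpret normed_space_on "c0_space :: (nat \<Rightarrow> 'k) set" sup_norm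
    by (rule normed_space_c0)
  show ?thesis
  proof
    fix X :: "nat \<Rightarrow> nat \<Rightarrow> 'k"
    assume X: "\<And>n. X n \<in> c0_space"
      and cauchy: "\<forall>e>0. \<exists>M. \<forall>m\<ge>M. \<forall>n\<ge>M. sup_norm (X m - X n) < e"
    have diff: "norm (X m i - X n i) \<le> sup_norm (X m - X n)" for m n i
      using norm_le_sup_norm[OF fs.subspace_diff[OF subspace_c0 X X], of m n i] by simp
    have "\<exists>l. (\<lambda>n. X n i) \<longlonglongrightarrow> l" for i
    proof -
      have "Cauchy (\<lambda>n. X n i)"
        unfolding Cauchy_def dist_norm using cauchy diff le_less_trans by meson
      then show ?thesis by (simp add: Cauchy_convergent_iff convergent_def)
    qed
    then obtain l where l: "\<And>i. (\<lambda>n. X n i) \<longlonglongrightarrow> l i" by metis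
    have unif: "\<exists>M. \<forall>n\<ge>M. \<forall>i. norm (X n i - l i) \<le> e" if "e > 0" for e
    proof -
      obtain M where M: "\<And>m n. m \<ge> M \<Longrightarrow> n \<ge> M \<Longrightarrow> sup_norm (X m - X n) < e"
        using cauchy \<open>e > 0\<close> by meson
      have "norm (X n i - l i) \<le> e" if "n \<ge> M" for n i
      proof (rule tendsto_upperbound)
        show "(\<lambda>m. norm (X n i - X m i)) \<longlonglongrightarrow> norm (X n i - l i)"
          by (intro tendsto_intros l)
        show "\<forall>\<^sub>F m in sequentially. norm (X n i - X m i) \<le> e"
          using eventually_ge_at_top[of M]
        proof eventually_elim
          case (elim m)
          show ?case using diff[of n i m] M[OF \<open>n \<ge> M\<close> elim] by linarith
        qed
      qed simp
      then show ?thesis by blast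
    qed
    have l0: "l \<in> c0_space"
      unfolding c0_space_def mem_Collect_eq LIMSEQ_iff
    proof (intro allI impI)
      fix e :: real assume e: "e > 0"
      obtain n where n: "\<And>i. norm (X n i - l i) \<le> e / 2"
        using unif[of "e / 2"] e by auto
      obtain I where I: "\<And>i. i \<ge> I \<Longrightarrow> norm (X n i) < e / 2"
        using X[of n] e unfolding c0_space_def mem_Collect_eq LIMSEQ_iff
        by (metis diff_zero half_gt_zero)
      have "norm (l i - 0) < e" if "i \<ge> I" for i
      proof -
        have "norm (l i) \<le> norm (X n i) + norm (X n i - l i)"
          using norm_triangle_ineq4[of "X n i" "X n i - l i"] by simp
        then show ?thesis using I[OF that] n[of i] by simp
      qed
      then show "\<exists>I. \<forall>i\<ge>I. norm (l i - 0) < e" by blast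
    qed
    have "(\<lambda>n. sup_norm (X n - l)) \<longlonglongrightarrow> 0"
      unfolding LIMSEQ_iff
    proof (intro allI impI)
      fix e :: real assume e: "e > 0"
      obtain M where M: "\<And>n i. n \<ge> M \<Longrightarrow> norm (X n i - l i) \<le> e / 2"
        using unif[of "e / 2"] e by auto
      have "norm (sup_norm (X n - l) - 0) < e" if "n \<ge> M" for n
      proof -
        have "sup_norm (X n - l) \<le> e / 2"
          using M[OF that] by (intro sup_norm_least) simp
        moreover have "0 \<le> sup_norm (X n - l)"
          by (intro sup_norm_nonneg fs.subspace_diff[OF subspace_c0] X l0)
        ultimately show ?thesis using e by simp
      qed
      then show "\<exists>M. \<forall>n\<ge>M. norm (sup_norm (X n - l) - 0) < e" by blast
    qed
    then show "\<exists>l\<in>c0_space. (\<lambda>n. sup_norm (X n - l)) \<longlonglongrightarrow> 0"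
      using l0 by blast
  qed
qed

lemma linear_on_sum:
  assumes "linear_on V (*) f" "fs.subspace V" "\<And>i. i \<in> A \<Longrightarrow> x i \<in> V"
  shows "f (\<Sum>i\<in>A. x i) = (\<Sum>i\<in>A. f (x i))"
  using assms(3)
proof (induction A rule: infinite_finite_induct)
  case (insert a A)
  then have "x a \<in> V" and "(\<Sum>i\<in>A. x i) \<in> V"
    by (auto intro: fs.subspace_sum[OF assms(2)])
  then have "f (x a + (\<Sum>i\<in>A. x i)) = f (x a) + f (\<Sum>i\<in>A. x i)"
    using assms(1) unfolding linear_on_def by blast
  with insert show ?case by (simp only: sum.insert insert_iff simp_thms)
next
  case empty
  have "f (pscale 0 0) = 0 * f 0"
    using assms(1,2) fs.subspace_0 unfolding linear_on_def by blast
  then show ?case by (simp add: pscale_def zero_fun_def)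
next
  case (infinite A)
  have "f (pscale 0 0) = 0 * f 0"
    using assms(1,2) fs.subspace_0 unfolding linear_on_def by blast
  with infinite show ?case by (simp add: pscale_def zero_fun_def)
qed

definition unit_vec :: "nat \<Rightarrow> nat \<Rightarrow> 'k::real_normed_field" where
  "unit_vec n = (\<lambda>i. if i = n then 1 else 0)"

lemma finite_support_c0:
  assumes "\<And>i. i \<ge> n \<Longrightarrow> x i = 0"
  shows "x \<in> c0_space"
  unfolding c0_space_def mem_Collect_eq
  by (rule tendsto_eventually) (use assms eventually_sequentially in auto)

lemma unit_vec_c0: "unit_vec n \<in> c0_space"
  by (rule finite_support_c0[of "Suc n"]) (auto simp: unit_vec_def)

lemma sum_unit_vec:
  "(\<Sum>k<n. pscale (c k) (unit_vec k)) = (\<lambda>i. if i < n then c i else 0)"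
proof
  fix i
  have "(\<Sum>k<n. pscale (c k) (unit_vec k)) i = (\<Sum>k<n. if k = i then c k else 0)"
    by (induction n) (auto simp: pscale_def unit_vec_def)
  also have "\<dots> = (if i < n then c i else 0)" by simp
  finally show "(\<Sum>k<n. pscale (c k) (unit_vec k)) i = (if i < n then c i else 0)" .
qed

lemma norm_dual_le:
  assumes f: "f \<in> dual_space V N" and x: "x \<in> V" "N x \<le> 1"
    and nonneg: "\<And>x. x \<in> V \<Longrightarrow> 0 \<le> N x"
  shows "norm (f x) \<le> dual_norm V N f"
proof -
  obtain C where C: "\<And>x. x \<in> V \<Longrightarrow> norm (f x) \<le> C * N x"
    using f by (auto simp: dual_space_def)
  have "norm (f x) \<le> \<bar>C\<bar>" if "x \<in> V" "N x \<le> 1" for x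
  proof -
    have "norm (f x) \<le> C * N x" using C that by blast
    also have "\<dots> \<le> \<bar>C\<bar> * N x" using nonneg[OF that(1)] by (intro mult_right_mono) auto
    also have "\<dots> \<le> \<bar>C\<bar> * 1" using that by (intro mult_left_mono) auto
    finally show ?thesis by simp
  qed
  then have "bdd_above ((\<lambda>x. norm (f x)) ` {x \<in> V. N x \<le> 1})"
    by (intro bdd_aboveI2) auto
  then show ?thesis
    unfolding dual_norm_def using x by (intro cSUP_upper) auto
qed

text \<open>
  Testing a functional on unimodular combinations of the unit vectors, which have norm at most
  \<open>1\<close>, shows that its coordinates lie in \<open>\<ell>\<^sub>1\<close>, with norm at most that of the functional.
\<close>

lemma sum_norm_dual_c0_le:
  fixes f :: "(nat \<Rightarrow> 'k::real_normed_field) \<Rightarrow> 'k"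
  assumes f: "f \<in> dual_space c0_space sup_norm"
  shows "(\<Sum>k<n. norm (f (unit_vec k))) \<le> dual_norm c0_space sup_norm f"
proof -
  define c where "c k = of_real (norm (f (unit_vec k))) / f (unit_vec k)" for k
  define x where "x = (\<Sum>k<n. pscale (c k) (unit_vec k))"
  have lin: "linear_on c0_space (*) f" using f by (simp add: dual_space_def)
  have x_eq: "x = (\<lambda>i. if i < n then c i else 0)"
    unfolding x_def by (rule sum_unit_vec)
  have x: "x \<in> c0_space"
    by (rule finite_support_c0[of n]) (simp add: x_eq)
  have "norm (c k) \<le> 1" for k
    by (simp add: c_def norm_divide)
  then have "sup_norm x \<le> 1"
    by (intro sup_norm_least) (simp add: x_eq)
  have "f x = (\<Sum>k<n. c k * f (unit_vec k))"
    unfolding x_def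
    by (subst linear_on_sum[OF lin subspace_c0])
      (use lin in \<open>auto simp: linear_on_def unit_vec_c0 intro: fs.subspace_scale[OF subspace_c0]\<close>)
  also have "\<dots> = of_real (\<Sum>k<n. norm (f (unit_vec k)))"
    unfolding of_real_sum by (intro sum.cong) (auto simp: c_def)
  finally have "norm (f x) = (\<Sum>k<n. norm (f (unit_vec k)))"
    by (simp add: sum_nonneg del: of_real_sum)
  moreover have "norm (f x) \<le> dual_norm c0_space sup_norm f"
    using f x \<open>sup_norm x \<le> 1\<close> sup_norm_nonneg by (rule norm_dual_le)
  ultimately show ?thesis by simp
qed

text \<open>
  The functional \<open>f \<mapsto> \<Sum>n. f e\<^sub>n\<close> on the dual is evaluation at the constant sequence \<open>1\<close>, which is
  not a null sequence.
\<close>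

lemma c0_not_reflexive:
  "\<not> reflexive_space (c0_space :: (nat \<Rightarrow> 'k::{real_normed_field, banach}) set) sup_norm"
proof
  let ?D = "dual_space (c0_space :: (nat \<Rightarrow> 'k) set) sup_norm"
  let ?DN = "dual_norm (c0_space :: (nat \<Rightarrow> 'k) set) sup_norm"
  assume refl: "reflexive_space (c0_space :: (nat \<Rightarrow> 'k) set) sup_norm"
  define \<Phi> where "\<Phi> f = (if f \<in> ?D then \<Sum>n. f (unit_vec n) else 0)" for f :: "(nat \<Rightarrow> 'k) \<Rightarrow> 'k"
  have sumn: "summable (\<lambda>n. norm (f (unit_vec n)))" if "f \<in> ?D" for f
    by (rule bounded_imp_summable[where B = "?DN f"])
      (auto simp only: lessThan_Suc_atMost[symmetric] norm_ge_zero sum_norm_dual_c0_le[OF that])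
  have summ: "summable (\<lambda>n. f (unit_vec n))" if "f \<in> ?D" for f
    using sumn[OF that] by (rule summable_norm_cancel)
  have add_D: "f + g \<in> ?D" if f: "f \<in> ?D" and g: "g \<in> ?D" for f g
  proof -
    obtain C where "\<And>x. x \<in> c0_space \<Longrightarrow> norm (f x) \<le> C * sup_norm x"
      using f by (auto simp: dual_space_def)
    moreover obtain C' where "\<And>x. x \<in> c0_space \<Longrightarrow> norm (g x) \<le> C' * sup_norm x"
      using g by (auto simp: dual_space_def)
    ultimately have "norm ((f + g) x) \<le> (C + C') * sup_norm x" if "x \<in> c0_space" for x
      using that norm_triangle_ineq[of "f x" "g x"] by (fastforce simp: algebra_simps)
    then have "\<exists>C. \<forall>x\<in>c0_space. norm ((f + g) x) \<le> C * sup_norm x" by blast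
    then show ?thesis
      using f g by (simp add: dual_space_def linear_on_def algebra_simps)
  qed
  have scale_D: "pscale c f \<in> ?D" if f: "f \<in> ?D" for c f
  proof -
    obtain C where "\<And>x. x \<in> c0_space \<Longrightarrow> norm (f x) \<le> C * sup_norm x"
      using f by (auto simp: dual_space_def)
    then have "norm (pscale c f x) \<le> (norm c * C) * sup_norm x" if "x \<in> c0_space" for x
      using that by (simp add: pscale_def norm_mult mult_left_mono mult.assoc)
    then have "\<exists>C. \<forall>x\<in>c0_space. norm (pscale c f x) \<le> C * sup_norm x" by blast
    then show ?thesis
      using f by (simp add: dual_space_def linear_on_def pscale_def[of c f] algebra_simps)
  qed
  have "\<Phi> \<in> dual_space ?D ?DN"
    unfolding dual_space_def[of ?D ?DN] mem_Collect_eq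
  proof (intro conjI allI impI)
    show "linear_on ?D (*) \<Phi>"
      unfolding linear_on_def
    proof (intro conjI ballI allI)
      fix f g assume "f \<in> ?D" "g \<in> ?D"
      then show "\<Phi> (f + g) = \<Phi> f + \<Phi> g"
        using suminf_add[OF summ summ, of f g] add_D by (simp add: \<Phi>_def)
    next
      fix c f assume "f \<in> ?D"
      then show "\<Phi> (pscale c f) = c * \<Phi> f"
        using suminf_mult[OF summ, of f c] scale_D by (simp add: \<Phi>_def pscale_def)
    qed
    have "norm (\<Phi> f) \<le> 1 * ?DN f" if f: "f \<in> ?D" for f
    proof -
      have "norm (\<Phi> f) \<le> (\<Sum>n. norm (f (unit_vec n)))"
        using f summable_norm[OF sumn] by (simp add: \<Phi>_def)
      also have "\<dots> \<le> ?DN f"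
        by (rule suminf_le_const[OF sumn[OF f] sum_norm_dual_c0_le[OF f]])
      finally show ?thesis by simp
    qed
    then show "\<exists>C. \<forall>f\<in>?D. norm (\<Phi> f) \<le> C * ?DN f" by blast
  qed (auto simp: \<Phi>_def)
  then obtain x where x: "x \<in> c0_space" and eq: "\<And>f. f \<in> ?D \<Longrightarrow> \<Phi> f = f x"
    using refl unfolding reflexive_space_def by blast
  have "x n = 1" for n
  proof -
    define f where "f y = (if y \<in> c0_space then y n else 0)" for y :: "nat \<Rightarrow> 'k"
    have "f \<in> ?D"
      unfolding dual_space_def linear_on_def mem_Collect_eq
    proof (intro conjI allI impI ballI)
      show "\<exists>C. \<forall>x\<in>c0_space. norm (f x) \<le> C * sup_norm x"
        by (rule exI[of _ 1]) (simp add: f_def norm_le_sup_norm)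
    qed (auto simp: f_def fs.subspace_add[OF subspace_c0] fs.subspace_scale[OF subspace_c0],
         auto simp: pscale_def)
    moreover have "f (unit_vec k) = unit_vec k n" for k
      by (simp add: f_def unit_vec_c0)
    then have "(\<lambda>k. f (unit_vec k)) = (\<lambda>k. if k = n then 1 else 0)"
      by (auto simp: unit_vec_def)
    then have "(\<lambda>k. f (unit_vec k)) sums 1"
      using sums_single[of n "\<lambda>_. 1 :: 'k"] by simp
    ultimately show ?thesis
      using eq[of f] x by (simp add: \<Phi>_def f_def sums_unique[symmetric])
  qed
  then have "x = (\<lambda>_. 1)" by auto
  with x show False
    by (simp add: c0_space_def LIMSEQ_const_iff)
qed


section \<open>Finite-dimensional spaces of null sequences\<close>

text \<open>
  A space spanned by finitely many null sequences is the range of a projection of finite rank that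
  is defined on all sequences and maps the unit ball of \<open>\<ell>\<^sub>\<infinity>\<close> to sequences dominated by a single
  null sequence \<open>t\<close>.  This replaces the compactness of the unit ball of the subspace.  For a further
  generator \<open>b\<close> a multiple of \<open>b - T b\<close> is added to \<open>T\<close>, the coefficient being read off
  from one coordinate at which \<open>b - T b\<close> does not vanish.
\<close>

lemma finite_rank_projection_c0:
  fixes B :: "(nat \<Rightarrow> 'k::real_normed_field) set"
  assumes "finite B" "B \<subseteq> c0_space"
  shows "\<exists>T t. linear_on UNIV pscale T \<and> (\<forall>x\<in>fs.span B. T x = x) \<and> t \<longlonglongrightarrow> (0::real) \<and>
           (\<forall>y K. (\<forall>i. norm (y i) \<le> K) \<longrightarrow> (\<forall>j. norm (T y j) \<le> t j * K))"
  using assms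
proof (induction B rule: finite_induct)
  case empty
  show ?case
    by (rule exI[of _ "\<lambda>_. 0"], rule exI[of _ "\<lambda>_. 0"])
      (auto simp: linear_on_def pscale_def[of _ "\<lambda>_. 0"])
next
  case (insert b B)
  then obtain T and t :: "nat \<Rightarrow> real"
    where T: "linear_on UNIV pscale T" and id: "\<And>x. x \<in> fs.span B \<Longrightarrow> T x = x"
      and t: "t \<longlonglongrightarrow> 0"
      and bd: "\<And>y K j. (\<And>i. norm (y i) \<le> K) \<Longrightarrow> norm (T y j) \<le> t j * K"
    by auto
  have b: "b \<in> c0_space" using insert.prems by auto
  have T_add: "T (x + y) = T x + T y" and T_scale: "T (pscale c x) = pscale c (T x)" for c x y
    using T by (auto simp: linear_on_def)
  define d where "d = b - T b"
  have d_c0: "d \<longlonglongrightarrow> 0"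
  proof -
    have bound: "norm (d j) \<le> norm (b j) + t j * sup_norm b" for j
      using norm_triangle_ineq4[of "b j" "T b j"] bd[of b "sup_norm b" j] norm_le_sup_norm[OF b]
      by (simp add: d_def)
    have "(\<lambda>j. norm (b j) + t j * sup_norm b) \<longlonglongrightarrow> norm (0::'k) + 0 * sup_norm b"
      using b t by (intro tendsto_intros) (auto simp: c0_space_def)
    then show ?thesis
      by (intro Lim_null_comparison[of d, OF always_eventually]) (use bound in auto)
  qed
  \<comment> \<open>On the enlarged span, \<open>T\<close> misses the identity by a multiple of \<open>d\<close>.\<close>
  have defect: "\<exists>c. y = T y + pscale c d" if "y \<in> fs.span (insert b B)" for y
  proof -
    obtain c where c: "y - pscale c b \<in> fs.span B"
      using \<open>y \<in> fs.span (insert b B)\<close> unfolding fs.span_insert by blast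
    have "T (y - pscale c b) + T (pscale c b) = T y"
      by (simp flip: T_add)
    then have "y = T y + pscale c d"
      using id[OF c] by (simp add: T_scale d_def fs.scale_right_diff_distrib algebra_simps)
    then show ?thesis by blast
  qed
  show ?case
  proof (cases "d = 0")
    case True
    have "\<forall>x\<in>fs.span (insert b B). T x = x"
      using defect True by (metis add.right_neutral fs.scale_zero_right)
    then show ?thesis using T t bd by blast
  next
    case False
    then obtain i where i: "d i \<noteq> 0" by (auto simp: fun_eq_iff)
    define q where "q y = (y i - T y i) / d i" for y
    define T' where "T' y = T y + pscale (q y) d" for y
    define t' where "t' j = t j + (1 + t i) / norm (d i) * norm (d j)" for j
    have "linear_on UNIV pscale T'"
      unfolding linear_on_def T'_def q_def T_add T_scale
      by (auto simp: pscale_def fun_eq_iff field_simps i)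
    moreover have "T' x = x" if "x \<in> fs.span (insert b B)" for x
    proof -
      obtain c where c: "x = T x + pscale c d" using defect[OF \<open>x \<in> fs.span (insert b B)\<close>] by blast
      then have "x i = T x i + c * d i" by (metis plus_fun_apply pscale_def)
      then have "q x = c" using i by (simp add: q_def)
      then show ?thesis using c by (simp add: T'_def)
    qed
    moreover have "t' \<longlonglongrightarrow> 0"
      unfolding t'_def by (rule tendsto_eq_intros t d_c0 refl)+ simp
    moreover have "norm (T' y j) \<le> t' j * K" if y: "\<And>i. norm (y i) \<le> K" for y K j
    proof -
      have "norm (y i - T y i) \<le> (1 + t i) * K"
        using norm_triangle_ineq4[of "y i" "T y i"] y[of i] bd[of y K i, OF y]
        by (simp add: algebra_simps)
      then have "norm (q y * d j) \<le> (1 + t i) * K / norm (d i) * norm (d j)"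
        unfolding q_def norm_mult norm_divide
        by (intro mult_right_mono divide_right_mono) auto
      then have "norm (T' y j) \<le> t j * K + (1 + t i) * K / norm (d i) * norm (d j)"
        using norm_triangle_ineq[of "T y j" "q y * d j"] bd[of y K j, OF y]
        by (simp add: T'_def pscale_def)
      then show ?thesis by (simp add: t'_def algebra_simps)
    qed
    ultimately show ?thesis by blast
  qed
qed

lemma finite_dim_c0_tails:
  fixes B :: "(nat \<Rightarrow> 'k::real_normed_field) set"
  assumes "finite B" "fs.span B \<subseteq> c0_space"
  obtains n where "\<And>x i. x \<in> fs.span B \<Longrightarrow> i \<ge> n \<Longrightarrow> norm (x i) \<le> sup_norm x / 2"
proof -
  have "B \<subseteq> c0_space" using assms(2) fs.span_superset by blast
  then obtain T and t :: "nat \<Rightarrow> real"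
    where id: "\<And>x. x \<in> fs.span B \<Longrightarrow> T x = x" and t: "t \<longlonglongrightarrow> 0"
      and bd: "\<And>y K j. (\<And>i. norm (y i) \<le> K) \<Longrightarrow> norm (T y j) \<le> t j * K"
    using finite_rank_projection_c0[OF assms(1)] by blast
  have "\<forall>\<^sub>F j in sequentially. t j < 1 / 2"
    using t by (rule order_tendstoD) simp
  then obtain n where n: "\<And>j. j \<ge> n \<Longrightarrow> t j < 1 / 2"
    by (auto simp: eventually_sequentially)
  have "norm (x i) \<le> sup_norm x / 2" if x: "x \<in> fs.span B" and i: "i \<ge> n" for x i
  proof -
    have x0: "x \<in> c0_space" using x assms(2) by blast
    have "norm (x i) \<le> t i * sup_norm x"
      using bd[of x "sup_norm x" i] norm_le_sup_norm[OF x0] id[OF x] by simp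
    also have "\<dots> \<le> 1 / 2 * sup_norm x"
      using n[OF i] sup_norm_nonneg[OF x0] by (intro mult_right_mono) auto
    finally show ?thesis by simp
  qed
  then show ?thesis by (rule that)
qed


section \<open>Flat blocks of decreasing length\<close>

lemma weights_partial_sums_unbounded:
  assumes "w \<in> weights"
  shows "\<exists>K. C \<le> (\<Sum>j<K. w j)"
proof (rule ccontr)
  assume "\<not> (\<exists>K. C \<le> (\<Sum>j<K. w j))"
  then have "(\<Sum>j<K. w j) \<le> C" for K by (meson linear)
  then have "summable w"
    using assms
    by (intro bounded_imp_summable[where B = C])
      (auto simp: weights_def less_imp_le simp del: sum.lessThan_Suc
        simp flip: lessThan_Suc_atMost)
  then show False using assms by (simp add: weights_def)
qed

lemma strict_mono_below:
  fixes \<phi> :: "nat \<Rightarrow> nat"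
  assumes "strict_mono \<phi>"
  obtains k where "k \<le> K" "\<And>j. \<phi> j < K \<longleftrightarrow> j < k"
proof
  define k where "k = (LEAST j. K \<le> \<phi> j)"
  have K: "K \<le> \<phi> K" using assms by (rule strict_mono_imp_increasing)
  show "k \<le> K" unfolding k_def using K by (rule Least_le)
  have "K \<le> \<phi> k" unfolding k_def using K by (rule LeastI)
  show "\<phi> j < K \<longleftrightarrow> j < k" for j
  proof
    assume "\<phi> j < K"
    with \<open>K \<le> \<phi> k\<close> have "\<phi> j < \<phi> k" by simp
    then show "j < k" using assms by (simp add: strict_mono_less)
  next
    assume "j < k"
    then show "\<phi> j < K" unfolding k_def using not_less_Least by force
  qed
qed

text \<open>
  Here \<open>u\<close> holds the \<open>p\<close>-th powers of the entries and \<open>\<beta>\<close> the number of the block of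
  each index; all blocks together have norm close to \<open>1\<close> although each has norm at least \<open>1\<close>.  The
  blocks are built from the right: with the sum \<open>S\<close> of the previous \<open>u\<close>, first \<open>k\<^sub>0\<close>
  is chosen so that after \<open>k\<^sub>0\<close> selected terms the old blocks contribute at most
  \<open>\<epsilon>\<close>, and then the new block in front is chosen so low that its first \<open>k\<^sub>0\<close> selected
  terms contribute at most \<open>\<epsilon>\<close>.
\<close>

lemma flat_blocks_almost_isometric:
  fixes n :: nat
  assumes w: "w \<in> weights" and "1 < R"
  shows "\<exists>u \<beta> L. (\<forall>j. 0 \<le> u j) \<and> (\<forall>j\<ge>L. u j = 0) \<and>
    (\<forall>\<phi> m. strict_mono \<phi> \<longrightarrow> (\<Sum>j<m. u (\<phi> j) * w j) \<le> R) \<and>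
    (\<forall>i<n. \<exists>s m. (\<forall>j<m. \<beta> (s + j) = i) \<and> 1 \<le> (\<Sum>j<m. u (s + j) * w j))"
  using \<open>1 < R\<close>
proof (induction n arbitrary: R)
  case 0
  then show ?case by (intro exI[of _ "\<lambda>_. 0"]) auto
next
  case (Suc n)
  define \<epsilon> where "\<epsilon> = (R - 1) / 2"
  have \<epsilon>: "0 < \<epsilon>" using Suc.prems by (simp add: \<epsilon>_def)
  have wpos: "0 < w j" and wdec: "i \<le> j \<Longrightarrow> w j \<le> w i" and wlim: "w \<longlonglongrightarrow> 0" for i j
    using w by (auto simp: weights_def decseq_def)
  obtain u \<beta> L where u0: "\<And>j. 0 \<le> u j" and L: "\<And>j. j \<ge> L \<Longrightarrow> u j = 0"
    and bd: "\<And>\<phi> m. strict_mono \<phi> \<Longrightarrow> (\<Sum>j<m. u (\<phi> j) * w j) \<le> 1 + \<epsilon>"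
    and bl: "\<And>i. i < n \<Longrightarrow> \<exists>s m. (\<forall>j<m. \<beta> (s + j) = i) \<and> 1 \<le> (\<Sum>j<m. u (s + j) * w j)"
  proof -
    have "1 < 1 + \<epsilon>" using \<epsilon> by simp
    from Suc.IH[OF this] that show ?thesis by blast
  qed
  define S where "S = (\<Sum>j<L. u j)"
  have S: "0 \<le> S" by (simp add: S_def sum_nonneg u0)
  have "(\<lambda>k. S * w k) \<longlonglongrightarrow> S * 0" by (intro tendsto_intros wlim)
  then have "\<forall>\<^sub>F k in sequentially. S * w k < \<epsilon>"
    using \<epsilon> by (intro order_tendstoD) auto
  then obtain k\<^sub>0 where k0: "S * w k\<^sub>0 < \<epsilon>"
    by (auto simp: eventually_sequentially)
  define P where "P k = (\<Sum>j<k. w j)" for k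
  have P0: "0 \<le> P k" for k using wpos by (simp add: P_def sum_nonneg less_imp_le)
  have Pmono: "P k \<le> P l" if "k \<le> l" for k l
    unfolding P_def using that wpos by (intro sum_mono2) (auto simp: less_imp_le)
  obtain K where "P k\<^sub>0 / \<epsilon> + 1 \<le> P K"
    using weights_partial_sums_unbounded[OF w] unfolding P_def by blast
  moreover have "0 \<le> P k\<^sub>0 / \<epsilon>" using P0 \<epsilon> by simp
  ultimately have PK: "0 < P K" and "P k\<^sub>0 / \<epsilon> \<le> P K" by linarith+
  then have Pk0: "P k\<^sub>0 / P K \<le> \<epsilon>" using \<epsilon> by (simp add: field_simps)
  define u' where "u' j = (if j < K then 1 / P K else u (j - K))" for j
  define \<beta>' where "\<beta>' j = (if j < K then n else \<beta> (j - K))" for j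
  have u'0: "0 \<le> u' j" for j using PK u0 by (simp add: u'_def)
  have "u' j = 0" if "j \<ge> L + K" for j using L that by (simp add: u'_def)
  moreover have "(\<Sum>j<m. u' (\<phi> j) * w j) \<le> R" if \<phi>: "strict_mono \<phi>" for \<phi> m
  proof -
    obtain k where "k \<le> K" and k: "\<And>j. \<phi> j < K \<longleftrightarrow> j < k"
      using strict_mono_below[OF \<phi>] by metis
    define \<psi> where "\<psi> j = \<phi> (j + k) - K" for j
    have \<phi>K: "K \<le> \<phi> (j + k)" for j using k[of "j + k"] by simp
    have \<psi>: "strict_mono \<psi>"
      using \<phi>K \<phi> by (auto simp: strict_mono_def \<psi>_def intro!: diff_less_mono)
    have head: "(\<Sum>j<k. u' (\<phi> j) * w j) = P k / P K"
      unfolding P_def[of k] sum_divide_distrib by (intro sum.cong) (auto simp: u'_def k)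
    have tail: "u' (\<phi> (j + k)) = u (\<psi> j)" for j
      using \<phi>K[of j] by (simp add: u'_def \<psi>_def)
    have "(\<Sum>j<m. u' (\<phi> j) * w j) \<le> (\<Sum>j<k + m. u' (\<phi> j) * w j)"
      using u'0 wpos by (intro sum_mono2) (auto simp: less_imp_le)
    also have "\<dots> = P k / P K + (\<Sum>j<m. u (\<psi> j) * w (j + k))"
    proof -
      have "(\<Sum>j<k + m. u' (\<phi> j) * w j) =
          (\<Sum>j<k. u' (\<phi> j) * w j) + (\<Sum>j<m. u' (\<phi> (k + j)) * w (k + j))"
        by (induction m) (simp_all add: add.assoc)
      then show ?thesis by (simp add: head tail add.commute[of k])
    qed
    also have "\<dots> \<le> R"
    proof (cases "k < k\<^sub>0")
      case True
      have "P k / P K \<le> P k\<^sub>0 / P K"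
        using Pmono[of k "k\<^sub>0"] True PK by (intro divide_right_mono) auto
      moreover have "(\<Sum>j<m. u (\<psi> j) * w (j + k)) \<le> (\<Sum>j<m. u (\<psi> j) * w j)"
        by (intro sum_mono mult_left_mono wdec u0) auto
      moreover have "R = 1 + 2 * \<epsilon>" unfolding \<epsilon>_def by argo
      ultimately show ?thesis using bd[OF \<psi>, of m] Pk0 by linarith
    next
      case False
      have "P k / P K \<le> 1" using Pmono[OF \<open>k \<le> K\<close>] PK by simp
      moreover have "(\<Sum>j<m. u (\<psi> j) * w (j + k)) \<le> (\<Sum>j<m. u (\<psi> j) * w k\<^sub>0)"
        using False by (intro sum_mono mult_left_mono wdec u0) auto
      moreover have "(\<Sum>j<m. u (\<psi> j)) \<le> S"
      proof -
        have "(\<Sum>j<m. u (\<psi> j)) = sum u (\<psi> ` {..<m})"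
          using \<psi> by (subst sum.reindex) (auto simp: strict_mono_imp_inj_on)
        also have "\<dots> \<le> sum u (\<psi> ` {..<m} \<union> {..<L})"
          by (intro sum_mono2) (auto simp: u0)
        also have "\<dots> = S"
          unfolding S_def by (intro sum.mono_neutral_right) (auto intro: L)
        finally show ?thesis .
      qed
      then have "(\<Sum>j<m. u (\<psi> j) * w k\<^sub>0) \<le> S * w k\<^sub>0"
        unfolding sum_distrib_right[symmetric]
        using wpos by (intro mult_right_mono) (auto simp: less_imp_le)
      ultimately have "P k / P K + (\<Sum>j<m. u (\<psi> j) * w (j + k)) \<le> 1 + \<epsilon>"
        using k0 by linarith
      also have "\<dots> \<le> R" using Suc.prems by (simp add: \<epsilon>_def field_simps)
      finally show ?thesis .
    qed
    finally show ?thesis .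
  qed
  moreover have "\<exists>s m. (\<forall>j<m. \<beta>' (s + j) = i) \<and> 1 \<le> (\<Sum>j<m. u' (s + j) * w j)"
    if "i < Suc n" for i
  proof (cases "i = n")
    case True
    have "(\<Sum>j<K. u' (0 + j) * w j) = (\<Sum>j<K. w j) / P K"
      unfolding sum_divide_distrib by (intro sum.cong) (auto simp: u'_def)
    also have "\<dots> = 1" using PK by (simp add: P_def)
    finally show ?thesis
      using True by (intro exI[of _ 0] exI[of _ K]) (auto simp: \<beta>'_def)
  next
    case False
    then obtain s m where "\<forall>j<m. \<beta> (s + j) = i" "1 \<le> (\<Sum>j<m. u (s + j) * w j)"
      using bl \<open>i < Suc n\<close> by (meson less_SucE)
    then show ?thesis
      by (intro exI[of _ "K + s"] exI[of _ m]) (auto simp: \<beta>'_def u'_def add.assoc)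
  qed
  ultimately show ?case using u'0 by blast
qed


section \<open>Embedding into the Garling space\<close>

lemma garling_sum_finite_support:
  fixes a :: "nat \<Rightarrow> 'k::real_normed_field" and L :: nat
  assumes "\<And>j. j \<ge> L \<Longrightarrow> a j = 0" and "strict_mono \<phi>"
  shows "summable (\<lambda>j. norm (a (\<phi> j)) powr p * w j)"
proof (rule summable_finite[of "{..<L}"])
  fix j assume "j \<notin> {..<L}"
  then have "L \<le> \<phi> j"
    using strict_mono_imp_increasing[OF assms(2), of j] by simp
  then show "norm (a (\<phi> j)) powr p * w j = 0" by (simp add: assms(1))
qed simp

lemma garling_sum_le:
  fixes a :: "nat \<Rightarrow> 'k::real_normed_field" and L :: nat
  assumes "\<And>j. j \<ge> L \<Longrightarrow> a j = 0" and "strict_mono \<phi>" and "0 < p" "0 \<le> C" and "\<And>j. 0 \<le> w j"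
    and "\<And>m. (\<Sum>j<m. norm (a (\<phi> j)) powr p * w j) \<le> C powr p"
  shows "garling_sum w p a \<phi> \<le> C"
proof -
  have summ: "summable (\<lambda>j. norm (a (\<phi> j)) powr p * w j)"
    by (rule garling_sum_finite_support[of L a \<phi>, OF assms(1,2)])
  have "(\<Sum>j. norm (a (\<phi> j)) powr p * w j) \<le> C powr p"
    by (rule suminf_le_const[OF summ assms(6)])
  moreover have "0 \<le> (\<Sum>j. norm (a (\<phi> j)) powr p * w j)"
    using assms(5) by (intro suminf_nonneg summ) simp
  ultimately have "garling_sum w p a \<phi> \<le> (C powr p) powr (1 / p)"
    unfolding garling_sum_def using \<open>0 < p\<close> by (intro powr_mono2) auto
  also have "\<dots> = C" using \<open>0 < p\<close> \<open>0 \<le> C\<close> by (simp add: powr_powr)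
  finally show ?thesis .
qed

lemma garling_norm_ge:
  assumes "a \<in> garling_space w p" and "strict_mono \<phi>" and "0 < p" "0 \<le> C" and "\<And>j. 0 \<le> w j"
    and "C powr p \<le> (\<Sum>j<m. norm (a (\<phi> j)) powr p * w j)"
  shows "C \<le> garling_norm w p a"
proof -
  have summ: "summable (\<lambda>j. norm (a (\<phi> j)) powr p * w j)"
    and bdd: "bdd_above (garling_sum w p a ` {\<phi>. strict_mono \<phi>})"
    using assms(1,2) by (auto simp: garling_space_def)
  have "C powr p \<le> (\<Sum>j. norm (a (\<phi> j)) powr p * w j)"
    using assms(6) by (rule order_trans) (intro sum_le_suminf summ, auto simp: assms(5))
  then have "(C powr p) powr (1 / p) \<le> garling_sum w p a \<phi>"
    unfolding garling_sum_def using \<open>0 < p\<close> by (intro powr_mono2) auto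
  moreover have "(C powr p) powr (1 / p) = C"
    using \<open>0 < p\<close> \<open>0 \<le> C\<close> by (simp add: powr_powr)
  moreover have "garling_sum w p a \<phi> \<le> garling_norm w p a"
    unfolding garling_norm_def using assms(2) bdd by (intro cSUP_upper) auto
  ultimately show ?thesis by simp
qed

text \<open>
  A subspace on which the first \<open>n\<close> coordinates determine the sup norm is embedded by multiplying
  the \<open>i\<close>-th of \<open>n\<close> disjoint blocks by the \<open>i\<close>-th coordinate.  The distortion comes from the
  bound \<open>r\<close> on the norm of the sum of the blocks alone.
\<close>

lemma c0_finitely_representable_in_garling:
  assumes "0 < p" and w: "w \<in> weights"
  shows "finitely_representable c0_space sup_norm
           (garling_space w p :: (nat \<Rightarrow> 'k::real_normed_field) set) (garling_norm w p)"
  unfolding finitely_representable_def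
proof (intro allI impI, elim conjE exE)
  fix F B :: "(nat \<Rightarrow> 'k) set" and r :: real
  assume F: "F \<subseteq> c0_space" and B: "finite B" "F = fs.span B" and r: "1 < r"
  have w0: "0 \<le> w j" for j using w by (auto simp: weights_def less_imp_le)
  obtain n where n: "\<And>x i. x \<in> F \<Longrightarrow> i \<ge> n \<Longrightarrow> norm (x i) \<le> sup_norm x / 2"
    using finite_dim_c0_tails[OF B(1)] F B(2) by metis
  have "1 < r powr p" using r \<open>0 < p\<close> by simp
  from flat_blocks_almost_isometric[OF w this, of n] obtain u L and \<beta> :: "nat \<Rightarrow> nat"
    where u0: "\<And>j. 0 \<le> u j" and L: "\<And>j. j \<ge> L \<Longrightarrow> u j = 0"
      and bd: "\<And>\<phi> m. strict_mono \<phi> \<Longrightarrow> (\<Sum>j<m. u (\<phi> j) * w j) \<le> r powr p"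
      and bl: "\<And>i. i < n \<Longrightarrow> \<exists>s m. (\<forall>j<m. \<beta> (s + j) = i) \<and> 1 \<le> (\<Sum>j<m. u (s + j) * w j)"
    by blast
  define T where "T x = (\<lambda>j. x (\<beta> j) * of_real (u j powr (1 / p)))" for x :: "nat \<Rightarrow> 'k"
  have T0: "T x j = 0" if "j \<ge> L" for x j using L that by (simp add: T_def)
  have normT: "norm (T x j) powr p = norm (x (\<beta> j)) powr p * u j" for x j
    using u0[of j] \<open>0 < p\<close> by (simp add: T_def norm_mult powr_mult powr_powr)
  have lin: "linear_on F pscale T"
    by (auto simp: linear_on_def T_def pscale_def fun_eq_iff algebra_simps)
  have upper: "garling_sum w p (T x) \<phi> \<le> r * sup_norm x"
    if x: "x \<in> c0_space" and \<phi>: "strict_mono \<phi>" for x \<phi>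
  proof (rule garling_sum_le[of L "T x" \<phi>, OF T0 \<phi> \<open>0 < p\<close> _ w0])
    show "0 \<le> r * sup_norm x" using r sup_norm_nonneg[OF x] by simp
    show "(\<Sum>j<m. norm (T x (\<phi> j)) powr p * w j) \<le> (r * sup_norm x) powr p" for m
    proof -
      have "(\<Sum>j<m. norm (T x (\<phi> j)) powr p * w j)
          \<le> (\<Sum>j<m. sup_norm x powr p * (u (\<phi> j) * w j))"
        unfolding normT mult.assoc using \<open>0 < p\<close>
        by (intro sum_mono mult_right_mono powr_mono2 norm_le_sup_norm x mult_nonneg_nonneg u0 w0)
          auto
      also have "\<dots> = sup_norm x powr p * (\<Sum>j<m. u (\<phi> j) * w j)"
        by (rule sum_distrib_left[symmetric])
      also have "\<dots> \<le> sup_norm x powr p * r powr p"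
        by (intro mult_left_mono bd \<phi>) simp
      also have "\<dots> = (r * sup_norm x) powr p"
        using r sup_norm_nonneg[OF x] by (simp add: powr_mult mult.commute)
      finally show ?thesis .
    qed
  qed
  have T_in: "T x \<in> garling_space w p" if x: "x \<in> c0_space" for x
    unfolding garling_space_def mem_Collect_eq
  proof (intro conjI allI impI)
    show "summable (\<lambda>j. norm (T x (\<phi> j)) powr p * w j)" if "strict_mono \<phi>" for \<phi>
      using T0 that by (rule garling_sum_finite_support)
    show "bdd_above (garling_sum w p (T x) ` {\<phi>. strict_mono \<phi>})"
      using upper[OF x] by (intro bdd_aboveI2) auto
  qed
  have coord: "norm (x i) \<le> garling_norm w p (T x)" if x: "x \<in> c0_space" and i: "i < n" for x i
  proof -
    obtain s m where s: "\<forall>j<m. \<beta> (s + j) = i" and ge: "1 \<le> (\<Sum>j<m. u (s + j) * w j)"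
      using bl[OF i] by blast
    have "norm (x i) powr p * 1 \<le> norm (x i) powr p * (\<Sum>j<m. u (s + j) * w j)"
      by (intro mult_left_mono ge) simp
    also have "\<dots> = (\<Sum>j<m. norm (T x (s + j)) powr p * w j)"
      unfolding normT sum_distrib_left by (intro sum.cong) (auto simp: s)
    finally show ?thesis
      by (intro garling_norm_ge[where \<phi> = "(+) s" and m = m, OF T_in[OF x] _ \<open>0 < p\<close> _ w0])
        (auto simp: strict_mono_def)
  qed
  have "inverse r * sup_norm x \<le> garling_norm w p (T x) \<and> garling_norm w p (T x) \<le> r * sup_norm x"
    if x: "x \<in> F" for x
  proof
    have x0: "x \<in> c0_space" using x F by blast
    let ?A = "garling_norm w p (T x)"
    have A0: "0 \<le> ?A"
      using \<open>0 < p\<close>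
      by (intro garling_norm_ge[where \<phi> = id and m = 0, OF T_in[OF x0] _ \<open>0 < p\<close> _ w0])
        (auto simp: strict_mono_def)
    have "norm (x i) \<le> max ?A (sup_norm x / 2)" for i
      using coord[OF x0, of i] n[OF x, of i] by (cases "i < n") auto
    then have "sup_norm x \<le> max ?A (sup_norm x / 2)"
      by (rule sup_norm_least)
    then have "sup_norm x \<le> ?A" using A0 by linarith
    moreover have "inverse r * sup_norm x \<le> 1 * sup_norm x"
      using r sup_norm_nonneg[OF x0] by (intro mult_right_mono) (auto simp: field_simps)
    ultimately show "inverse r * sup_norm x \<le> ?A" by simp
    show "?A \<le> r * sup_norm x"
      unfolding garling_norm_def
    proof (rule cSUP_least)
      show "{\<phi> :: nat \<Rightarrow> nat. strict_mono \<phi>} \<noteq> {}" using strict_mono_id by blast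
    qed (use upper[OF x0] in auto)
  qed
  with lin T_in F
  show "\<exists>T. linear_on F pscale T \<and> T ` F \<subseteq> garling_space w p \<and>
      (\<forall>x\<in>F. inverse r * sup_norm x \<le> garling_norm w p (T x) \<and>
        garling_norm w p (T x) \<le> r * sup_norm x)"
    by (intro exI[of _ T]) auto
qed

lemma garling_not_superreflexive:
  assumes "0 < p" and "w \<in> weights"
  shows "\<not> superreflexive
    (garling_space w p :: (nat \<Rightarrow> 'k::{real_normed_field, banach}) set) (garling_norm w p)"
  using banach_space_c0 c0_finitely_representable_in_garling[OF assms] c0_not_reflexive
  unfolding superreflexive_def by blast

theorem theorem1p2:
  fixes p :: real and w :: "nat \<Rightarrow> real"
  assumes "1 \<le> p" and "w \<in> weights"
  shows "\<not> superreflexive (garling_space w p :: (nat \<Rightarrow> real) set) (garling_norm w p) \<and>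
         \<not> superreflexive (garling_space w p :: (nat \<Rightarrow> complex) set) (garling_norm w p)"
  using assms by (simp add: garling_not_superreflexive)

end
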